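(* Let $\Omega \subseteq \mathbb{R}^d$ be a bounded convex domain which is symmetric with respect to $0$. If $\Omega$ is spectral, then $\Omega$ is a Turán domain.
   Context: A domain is a nonempty open connected subset of $\mathbb{R}^d$; $\Omega$ is symmetric if $\Omega=-\Omega$. $|\Omega|$ denotes Lebesgue measure, and $\widehat{f}(\xi)=\int_{\mathbb{R}^d} f(x)e^{-2\pi i\langle \xi,x\rangle}\,dx$ is the Fourier transform. Spectral sets. For $\lambda\in\mathbb{R}^d$ put $e_\lambda(x)=\exp(2\pi i\langle\lambda,x\rangle)$. A measurable set $\Omega\subseteq\mathbb{R}^d$ is called spectral if there is a discrete set $\Lambda\subset\mathbb{R}^d$ such that $E_\Lambda=\{e_\lambda:\lambda\in\Lambda\}$ is an orthogonal basis (that is, a complete orthogonal system) of $L^2(\Omega)$ with inner product $\langle f,g\rangle_\Omega=\int_\Omega f\overline{g}$. Turán domains. A positive definite function here means a continuous integrable function $f:\mathbb{R}^d\to\mathbb{C}$ whose Fourier transform is nonnegative, $\widehat f\ge 0$; it is supported in $\Omega$ if it vanishes outside $\Omega$. A symmetric convex domain $\Omega$ is called a Turán domain if the maximum of $\int_{\mathbb{R}^d} f$ over all positive definite functions $f$ supported in $\Omega$ with $f(0)=1$ is achieved by the function $$f=\frac{2^d}{|\Omega|}\,\chi_{\frac12\Omega}*\chi_{\frac12\Omega},$$ whose integral is $2^{-d}|\Omega|$. Here $\chi_E$ is the indicator function of $E$ and $*$ is convolution. Equivalently, $\int f\le 2^{-d}|\Omega|$ for every such $f$. *)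

theory Defs
  imports "HOL-Analysis.Analysis"
begin

definition is_domain :: "'a::euclidean_space set \<Rightarrow> bool" where
  "is_domain \<Omega> \<longleftrightarrow> \<Omega> \<noteq> {} \<and> open \<Omega> \<and> connected \<Omega>"

definition symmetric_set :: "'a::euclidean_space set \<Rightarrow> bool" where
  "symmetric_set \<Omega> \<longleftrightarrow> uminus ` \<Omega> = \<Omega>"


text \<open>
  Elements of \<open>L\<^sup>2(\<Omega>)\<close> are represented by functions on the whole space, of which only the values
  on \<open>\<Omega>\<close> matter; functions that agree almost everywhere are not identified.
\<close>

definition L2 :: "'a::euclidean_space set \<Rightarrow> ('a \<Rightarrow> complex) set" where
  "L2 \<Omega> = {f. f \<in> borel_measurable (lebesgue_on \<Omega>) \<and>
              integrable (lebesgue_on \<Omega>) (\<lambda>x. (cmod (f x))\<^sup>2)}"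

definition L2_inner :: "'a::euclidean_space set \<Rightarrow> ('a \<Rightarrow> complex) \<Rightarrow> ('a \<Rightarrow> complex) \<Rightarrow> complex" where
  "L2_inner \<Omega> f g = (\<integral>x. f x * cnj (g x) \<partial>lebesgue_on \<Omega>)"

definition L2_norm :: "'a::euclidean_space set \<Rightarrow> ('a \<Rightarrow> complex) \<Rightarrow> real" where
  "L2_norm \<Omega> f = sqrt (\<integral>x. (cmod (f x))\<^sup>2 \<partial>lebesgue_on \<Omega>)"

text \<open>
  The last conjunct says that the complex linear span of \<open>E\<close> is dense in \<open>L\<^sup>2(\<Omega>)\<close>.
\<close>

definition orthogonal_basis_L2 :: "'a::euclidean_space set \<Rightarrow> ('a \<Rightarrow> complex) set \<Rightarrow> bool" where
  "orthogonal_basis_L2 \<Omega> E \<longleftrightarrow>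
     E \<subseteq> L2 \<Omega> \<and>
     (\<forall>u\<in>E. L2_norm \<Omega> u \<noteq> 0) \<and>
     (\<forall>u\<in>E. \<forall>v\<in>E. u \<noteq> v \<longrightarrow> L2_inner \<Omega> u v = 0) \<and>
     (\<forall>f\<in>L2 \<Omega>. \<forall>\<epsilon>>0. \<exists>F c. finite F \<and> F \<subseteq> E \<and>
        L2_norm \<Omega> (\<lambda>x. f x - (\<Sum>u\<in>F. c u * u x)) < \<epsilon>)"

definition expfun :: "'a::euclidean_space \<Rightarrow> 'a \<Rightarrow> complex" where
  "expfun \<mu> x = exp (2 * of_real pi * \<i> * of_real (\<mu> \<bullet> x))"

definition spectral_set :: "'a::euclidean_space set \<Rightarrow> bool" where
  "spectral_set \<Omega> \<longleftrightarrow> \<Omega> \<in> sets lebesgue \<and>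
     (\<exists>\<Lambda>. discrete \<Lambda> \<and> orthogonal_basis_L2 \<Omega> (expfun ` \<Lambda>))"


definition fourier :: "('a::euclidean_space \<Rightarrow> complex) \<Rightarrow> 'a \<Rightarrow> complex" where
  "fourier f \<xi> = (\<integral>x. f x * exp (- 2 * of_real pi * \<i> * of_real (\<xi> \<bullet> x)) \<partial>lebesgue)"

definition positive_definite_fun :: "('a::euclidean_space \<Rightarrow> complex) \<Rightarrow> bool" where
  "positive_definite_fun f \<longleftrightarrow>
     continuous_on UNIV f \<and> integrable lebesgue f \<and> (\<forall>\<xi>. fourier f \<xi> \<in> \<real>\<^sub>\<ge>\<^sub>0)"

definition supported_in :: "('a::euclidean_space \<Rightarrow> complex) \<Rightarrow> 'a set \<Rightarrow> bool" where
  "supported_in f \<Omega> \<longleftrightarrow> (\<forall>x. x \<notin> \<Omega> \<longrightarrow> f x = 0)"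

definition convolve ::
  "('a::euclidean_space \<Rightarrow> complex) \<Rightarrow> ('a \<Rightarrow> complex) \<Rightarrow> 'a \<Rightarrow> complex" where
  "convolve f g x = (\<integral>y. f y * g (x - y) \<partial>lebesgue)"

definition turan_admissible :: "'a::euclidean_space set \<Rightarrow> ('a \<Rightarrow> complex) \<Rightarrow> bool" where
  "turan_admissible \<Omega> f \<longleftrightarrow> positive_definite_fun f \<and> supported_in f \<Omega> \<and> f 0 = 1"

definition turan_fun :: "'a::euclidean_space set \<Rightarrow> 'a \<Rightarrow> complex" where
  "turan_fun \<Omega> x = of_real (2 ^ DIM('a) / measure lebesgue \<Omega>) *
     convolve (indicator ((*\<^sub>R) (1/2) ` \<Omega>)) (indicator ((*\<^sub>R) (1/2) ` \<Omega>)) x"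

text \<open>
  The integral of a positive definite function is its Fourier transform at \<open>0\<close>, hence a
  nonnegative real, so comparing real parts compares the integrals themselves. Being a maximizer
  includes being admissible.
\<close>

definition turan_domain :: "'a::euclidean_space set \<Rightarrow> bool" where
  "turan_domain \<Omega> \<longleftrightarrow> is_domain \<Omega> \<and> convex \<Omega> \<and> symmetric_set \<Omega> \<and>
     is_arg_max (\<lambda>f. Re (\<integral>x. f x \<partial>lebesgue)) (turan_admissible \<Omega>) (turan_fun \<Omega>)"

end

theory Submission
  imports Defs
begin

text \<open>
  Let \<open>\<Lambda>\<close> be a spectrum of \<open>\<Omega>\<close>. Parseval's identity says that \<open>F = h * k\<^sup>~\<close>, with
  \<open>k\<^sup>~ x = cnj (k (- x))\<close> and \<open>h, k\<close> in \<open>L\<^sup>2(\<Omega>)\<close>, satisfies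
  \<open>(\<Sum>\<lambda>\<in>\<Lambda>. fourier F (\<lambda> - a)) = |\<Omega>| F 0\<close> for every \<open>a\<close>. If \<open>G\<close> lives on a compact subset of
  \<open>2\<Omega>\<close> and \<open>\<psi>\<close> on a small ball, then cutting \<open>G\<close> into pieces of small diameter writes \<open>G * \<psi>\<close> as a
  finite sum of such convolutions, so the identity holds for \<open>G * \<psi>\<close> as well. When \<open>G\<close> and \<open>\<psi>\<close> are positive
  definite and \<open>a \<in> \<Lambda>\<close>, dropping all terms but \<open>\<lambda> = a\<close> gives
  \<open>(\<integral>G) (\<integral>\<psi>) \<le> |\<Omega>| (\<integral>G \<psi>)\<close>, and letting \<open>\<psi>\<close> concentrate at \<open>0\<close> gives \<open>\<integral>G \<le> |\<Omega>| G 0\<close>.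
  For \<open>f\<close> supported in \<open>\<Omega>\<close> this is applied to \<open>G x = f (x / 2s)\<close> with \<open>s\<close> tending to \<open>1\<close> from below;
  the factor \<open>2 ^ d\<close> comes from this dilation.
\<close>

section \<open>Integration and exponentials\<close>

text \<open>Lebesgue measure is \<open>\<bar>c\<bar>^DIM('a)\<close> times its image under the
  affine map. Only measurability is assumed, so translations (\<open>c = 1\<close>), the reflection
  (\<open>c = -1\<close>) and dilations apply without an integrability check.\<close>

lemma lborel_integral_affine:
  fixes f :: "'a::euclidean_space \<Rightarrow> 'b::{banach, second_countable_topology}"
  assumes m [measurable]: "f \<in> borel_measurable borel" and "c \<noteq> 0"
  shows "(\<integral>x. f x \<partial>lborel) = \<bar>c\<bar>^DIM('a) *\<^sub>R (\<integral>x. f (t + c *\<^sub>R x) \<partial>lborel)"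
proof -
  have "(\<integral>x. f x \<partial>lborel)
      = (\<integral>x. f x \<partial>density (distr lborel borel (\<lambda>x. t + c *\<^sub>R x)) (\<lambda>_. \<bar>c\<bar>^DIM('a)))"
    using lborel_affine[OF assms(2), of t] by simp
  also have "\<dots> = (\<integral>x. \<bar>c\<bar>^DIM('a) *\<^sub>R f x \<partial>distr lborel borel (\<lambda>x. t + c *\<^sub>R x))"
    using m by (subst integral_density) auto
  also have "\<dots> = (\<integral>x. \<bar>c\<bar>^DIM('a) *\<^sub>R f (t + c *\<^sub>R x) \<partial>lborel)"
    using m by (subst integral_distr) auto
  finally show ?thesis by simp
qed

lemma integrable_bounded_support:
  fixes f :: "'a::euclidean_space \<Rightarrow> 'b::{banach, second_countable_topology}"
  assumes [measurable]: "f \<in> borel_measurable borel"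
    and B: "\<And>x. norm (f x) \<le> B" and S: "bounded S" "\<And>x. x \<notin> S \<Longrightarrow> f x = 0"
  shows "integrable lborel f"
proof -
  obtain a b where ab: "S \<subseteq> cbox a b" using bounded_subset_cbox_symmetric[OF S(1)] by blast
  show ?thesis
  proof (rule Bochner_Integration.integrable_bound)
    show "integrable lborel (\<lambda>x. B * indicator (cbox a b) x)"
      by (intro integrable_mult_right)
        (simp add: integrable_indicator_iff emeasure_bounded_finite[of "cbox a b", simplified])
    have "norm (f x) \<le> norm (B * indicator (cbox a b) x)" for x
    proof (cases "x \<in> S")
      case True
      then show ?thesis
        using ab B[of x] by (auto simp: indicator_def)
    qed (simp add: S(2))
    then show "AE x in lborel. norm (f x) \<le> norm (B * indicator (cbox a b) x)"
      by simp
  qed measurable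
qed

lemma continuous_on_expfun [continuous_intros]: "continuous_on S (expfun \<mu>)"
  unfolding expfun_def by (intro continuous_intros)

lemma borel_measurable_expfun [measurable]: "expfun \<mu> \<in> borel_measurable borel"
  by (intro borel_measurable_continuous_onI continuous_intros)

lemma norm_expfun [simp]: "cmod (expfun \<mu> x) = 1"
  unfolding expfun_def by (simp add: norm_exp_eq_Re)

lemma cnj_expfun: "cnj (expfun \<mu> x) = expfun (- \<mu>) x"
  unfolding expfun_def by (simp add: exp_cnj)

lemma expfun_add_left: "expfun (\<mu> + \<nu>) x = expfun \<mu> x * expfun \<nu> x"
  unfolding expfun_def by (simp add: exp_add[symmetric] algebra_simps inner_add_left)

lemma expfun_add_right: "expfun \<mu> (x + y) = expfun \<mu> x * expfun \<mu> y"
  unfolding expfun_def by (simp add: exp_add[symmetric] algebra_simps inner_add_right)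

lemma expfun_zero [simp]: "expfun 0 x = 1" "expfun \<mu> 0 = 1"
  by (simp_all add: expfun_def)

lemma expfun_uminus: "expfun (- \<mu>) x = expfun \<mu> (- x)"
  by (simp add: expfun_def)

text \<open>\<open>fourier\<close> integrates over the completed measure; for Borel functions the
  value is the same over \<open>lborel\<close>, where Fubini and affine substitutions are
  available.\<close>

lemma fourier_lborel:
  assumes [measurable]: "f \<in> borel_measurable borel"
  shows "fourier f \<xi> = (\<integral>x. f x * expfun (- \<xi>) x \<partial>lborel)"
proof -
  have "fourier f \<xi> = (\<integral>x. f x * expfun (- \<xi>) x \<partial>lebesgue)"
    unfolding fourier_def expfun_def by (simp add: exp_minus)
  then show ?thesis by (simp add: integral_completion)
qed

lemma measure_lebesgue_open_pos:
  fixes S :: "'a::euclidean_space set"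
  assumes "open S" "bounded S" "S \<noteq> {}"
  shows "measure lebesgue S > 0"
  using open_not_negligible[OF assms(1,3)] lmeasurable_open[OF assms(2,1)]
  by (simp add: negligible_iff_measure zero_less_measure_iff)

section \<open>The extremal function\<close>

lemma convolve_indicator:
  fixes K :: "'a::euclidean_space set"
  assumes [measurable]: "K \<in> sets borel"
  shows "convolve (indicator K) (indicator K) x
       = of_real (\<integral>y. indicator K y * indicator K (x - y) \<partial>lborel)"
proof -
  have "convolve (indicator K) (indicator K) x
      = (\<integral>y. indicator K y * indicator K (x - y) \<partial>lborel)"
    unfolding convolve_def by (rule integral_completion) measurable
  also have "\<dots> = (\<integral>y. complex_of_real (indicator K y * indicator K (x - y)) \<partial>lborel)"
    by (intro Bochner_Integration.integral_cong) (auto simp: indicator_def)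
  finally show ?thesis unfolding integral_complex_of_real .
qed

text \<open>Dominated convergence along a sequence tending to \<open>x\<close>, with majorant
  \<open>indicator K\<close>. The integrand converges at every \<open>y\<close> for which
  \<open>x - y\<close> is off the frontier of \<open>K\<close>, and the frontier of a convex set is
  negligible.\<close>

lemma continuous_on_convolve_indicator:
  fixes K :: "'a::euclidean_space set"
  assumes "open K" "bounded K" "convex K"
  shows "continuous_on UNIV (\<lambda>x. \<integral>y. indicator K y * indicator K (x - y) \<partial>lborel :: real)"
  unfolding continuous_on_sequentially
proof (intro allI ballI impI; elim conjE)
  fix x :: 'a and X assume X: "X \<longlonglongrightarrow> x"
  have [measurable]: "K \<in> sets borel" using assms(1) by auto
  have "frontier K \<in> null_sets lebesgue"
    using negligible_convex_frontier[OF assms(3)] by (simp add: negligible_iff_null_sets)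
  \<comment> \<open>The map \<open>y \<mapsto> x - y\<close> is an involution preserving null sets,
    so almost every \<open>y\<close> has \<open>x - y\<close> off the frontier.\<close>
  then have "(\<lambda>z. (-1) *\<^sub>R z + x) ` frontier K \<in> null_sets lebesgue"
    using emeasure_lebesgue_affine[of "-1" x "frontier K"]
      compact_continuous_image[OF _ compact_frontier_bounded[OF assms(2)], of "\<lambda>z. (-1) *\<^sub>R z + x"]
    by (auto simp: null_sets_def continuous_intros compact_imp_closed)
  then have "AE y in lebesgue. y \<notin> (\<lambda>z. (-1) *\<^sub>R z + x) ` frontier K"
    by (rule AE_not_in)
  then have "AE y in lborel. y \<notin> (\<lambda>z. (-1) *\<^sub>R z + x) ` frontier K"
    by (simp add: AE_completion_iff)
  then have lim: "AE y in lborel. (\<lambda>n. indicator K y * indicator K (X n - y) :: real)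
      \<longlonglongrightarrow> indicator K y * indicator K (x - y)"
  proof eventually_elim
    case (elim y)
    have nf: "x - y \<notin> frontier K"
    proof
      assume "x - y \<in> frontier K"
      then have "(-1) *\<^sub>R (x - y) + x \<in> (\<lambda>z. (-1) *\<^sub>R z + x) ` frontier K" by (rule imageI)
      with elim show False by simp
    qed
    have Xy: "(\<lambda>n. X n - y) \<longlonglongrightarrow> x - y" by (intro tendsto_intros X)
    have "\<forall>\<^sub>F n in sequentially. indicator K (X n - y) = (indicator K (x - y) :: real)"
    proof (cases "x - y \<in> K")
      case True
      with Xy assms(1) have "\<forall>\<^sub>F n in sequentially. X n - y \<in> K" by (rule topological_tendstoD)
      then show ?thesis by eventually_elim (simp add: True)
    next
      case False
      with nf have "x - y \<in> - closure K"
        using assms(1) by (auto simp: frontier_def interior_open)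
      with Xy have "\<forall>\<^sub>F n in sequentially. X n - y \<in> - closure K"
        by (intro topological_tendstoD) auto
      then show ?thesis
        by eventually_elim (use False closure_subset[of K] in \<open>auto simp: indicator_def\<close>)
    qed
    then have "(\<lambda>n. indicator K (X n - y) :: real) \<longlonglongrightarrow> indicator K (x - y)"
      by (rule tendsto_eventually)
    then show ?case by (intro tendsto_intros)
  qed
  show "((\<lambda>x. \<integral>y. indicator K y * indicator K (x - y) \<partial>lborel :: real) \<circ> X)
      \<longlonglongrightarrow> (\<integral>y. indicator K y * indicator K (x - y) \<partial>lborel)"
    unfolding o_def
  proof (rule integral_dominated_convergence[where w = "indicator K", OF _ _ _ lim])
    have "emeasure lborel K < \<infinity>"
      using assms(2) emeasure_bounded_finite by blast
    then show "integrable lborel (indicator K :: 'a \<Rightarrow> real)" by (simp add: integrable_indicator_iff)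
  qed (auto simp: indicator_def)
qed

text \<open>Fubini and the translation \<open>x \<mapsto> y + x\<close> factor the double integral,
  because \<open>expfun \<mu>\<close> is multiplicative. The result is a plain square, not a squared
  modulus; its sign is settled later by the symmetry of \<open>K\<close>.\<close>

lemma fourier_convolve_indicator:
  fixes K :: "'a::euclidean_space set"
  assumes [measurable]: "K \<in> sets borel" and "bounded K"
  shows "(\<integral>x. of_real (\<integral>y. indicator K y * indicator K (x - y) \<partial>lborel) * expfun \<mu> x \<partial>lborel)
       = (\<integral>y. indicator K y * expfun \<mu> y \<partial>lborel)\<^sup>2"
proof -
  let ?f = "\<lambda>x y. indicator K y * indicator K (x - y) * expfun \<mu> x :: complex"
  have m: "case_prod ?f \<in> borel_measurable (lborel \<Otimes>\<^sub>M lborel)"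
    by measurable
  obtain B where B: "\<And>x. x \<in> K \<Longrightarrow> norm x \<le> B" using assms(2) by (auto simp: bounded_iff)
  have "integrable lborel (case_prod ?f)"
  \<comment> \<open>The integrand is nonzero only if \<open>y\<close> and \<open>x - y\<close> lie
    in \<open>K\<close>, hence \<open>norm y \<le> B\<close> and \<open>norm x \<le> 2 * B\<close>.
    This gives the joint integrability that Fubini requires.\<close>
  proof (rule integrable_bounded_support[where B = 1 and S = "cball 0 (2 * B) \<times> cball 0 B"])
    show "case_prod ?f \<in> borel_measurable borel"
      using m unfolding lborel_prod by simp
    fix p :: "'a \<times> 'a"
    obtain x y where p: "p = (x, y)" by (cases p)
    show "cmod (case_prod ?f p) \<le> 1" by (simp add: p norm_mult indicator_def)
    assume "p \<notin> cball 0 (2 * B) \<times> cball 0 B"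
    then have "\<not> (y \<in> K \<and> x - y \<in> K)"
      using B[of y] B[of "x - y"] norm_triangle_ineq[of "x - y" y] by (auto simp: p)
    then show "case_prod ?f p = 0" by (auto simp: p)
  qed (simp add: bounded_Times)
  then have int: "integrable (lborel \<Otimes>\<^sub>M lborel) (case_prod ?f)"
    by (simp add: lborel_prod)
  have "(\<integral>x. of_real (\<integral>y. indicator K y * indicator K (x - y) \<partial>lborel) * expfun \<mu> x \<partial>lborel)
      = (\<integral>x. (\<integral>y. ?f x y \<partial>lborel) \<partial>lborel)"
    by (intro Bochner_Integration.integral_cong)
      (auto simp flip: integral_complex_of_real simp: of_real_indicator)
  also have "\<dots> = (\<integral>y. (\<integral>x. ?f x y \<partial>lborel) \<partial>lborel)"
    by (rule lborel_pair.Fubini_integral[OF int, symmetric])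
  also have "\<dots> = (\<integral>y. indicator K y * expfun \<mu> y * (\<integral>x. indicator K x * expfun \<mu> x \<partial>lborel) \<partial>lborel)"
  proof (rule Bochner_Integration.integral_cong[OF refl])
    fix y
    have "(\<integral>x. ?f x y \<partial>lborel) = (\<integral>x. ?f (y + 1 *\<^sub>R x) y \<partial>lborel)"
      by (subst lborel_integral_affine[where c = 1 and t = y]) (simp_all, measurable)
    also have "\<dots> = (\<integral>x. indicator K y * expfun \<mu> y * (indicator K x * expfun \<mu> x) \<partial>lborel)"
      by (simp add: expfun_add_right mult_ac)
    finally show "(\<integral>x. ?f x y \<partial>lborel)
        = indicator K y * expfun \<mu> y * (\<integral>x. indicator K x * expfun \<mu> x \<partial>lborel)" by simp
  qed
  also have "\<dots> = (\<integral>y. indicator K y * expfun \<mu> y \<partial>lborel)\<^sup>2"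
    by (simp add: power2_eq_square)
  finally show ?thesis .
qed

lemma symmetric_setD: "symmetric_set S \<Longrightarrow> - x \<in> S \<longleftrightarrow> x \<in> S"
  unfolding symmetric_set_def by (metis imageE imageI minus_minus)

lemma indicator_uminus:
  "symmetric_set K \<Longrightarrow> indicator K (- x) = indicator K x"
  by (simp add: indicator_def symmetric_setD)

text \<open>The bump \<open>\<psi>\<close> in the upper bound is such a function; pointwise
  nonnegativity identifies the integral of its modulus with its own integral.\<close>

lemma turan_fun_nonneg:
  assumes "open \<Omega>"
  shows "turan_fun \<Omega> x \<in> \<real>\<^sub>\<ge>\<^sub>0"
proof -
  have "(*\<^sub>R) (1/2) ` \<Omega> \<in> sets borel"
    using open_scaling[OF _ assms, of "1/2"] by simp
  note convolve_indicator[OF this, of x]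
  moreover have "(\<integral>y. indicator ((*\<^sub>R) (1/2) ` \<Omega>) y * indicator ((*\<^sub>R) (1/2) ` \<Omega>) (x - y) \<partial>lborel) \<ge> (0::real)"
    by (intro Bochner_Integration.integral_nonneg) auto
  ultimately show ?thesis
    unfolding turan_fun_def by (simp flip: of_real_mult of_real_power)
qed

context
  fixes \<Omega> :: "'a::euclidean_space set"
  assumes \<Omega>: "\<Omega> \<noteq> {}" "open \<Omega>" "bounded \<Omega>" "convex \<Omega>" "symmetric_set \<Omega>"
begin

text \<open>Let \<open>K\<close> be half of \<open>\<Omega>\<close>. Convexity gives
  \<open>K + K \<subseteq> \<Omega>\<close>, hence the support. The transform is a positive multiple
  of the square of the transform of \<open>indicator K\<close>, which is real by symmetry. The
  integral is read off as the transform at \<open>0\<close>.\<close>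

lemma turan_admissible_integral_turan_fun:
  "turan_admissible \<Omega> (turan_fun \<Omega>)"
  "(\<integral>x. turan_fun \<Omega> x \<partial>lebesgue) = of_real (measure lebesgue \<Omega> / 2 ^ DIM('a))"
proof -
  define K where "K = (*\<^sub>R) (1/2) ` \<Omega>"
  have K: "open K" "bounded K" "convex K"
    unfolding K_def using \<Omega> open_scaling[of "1/2" \<Omega>] by (auto intro: bounded_scaling convex_scaling)
  have symK: "symmetric_set K"
  proof -
    have "uminus ` K = (*\<^sub>R) (1/2) ` (uminus ` \<Omega>)"
      unfolding K_def image_image by simp
    then show ?thesis
      using \<Omega>(5) by (simp add: symmetric_set_def K_def)
  qed
  have [measurable]: "K \<in> sets borel" using K(1) by auto
  define g where "g x = (\<integral>y. indicator K y * indicator K (x - y) \<partial>lborel :: real)" for x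
  define N where "N = measure lebesgue \<Omega>"
  have N: "N > 0"
    unfolding N_def using \<Omega> by (intro measure_lebesgue_open_pos)
  \<comment> \<open>So the factor \<open>2 ^ DIM('a) / N\<close> is the reciprocal of the measure of
    \<open>K\<close>; this makes the value at \<open>0\<close> equal to 1 and bounds the function by
    1.\<close>
  have MK: "measure lborel K = N / 2 ^ DIM('a)"
  proof -
    have "measure lborel K = measure lebesgue K" by simp
    also have "\<dots> = N / 2 ^ DIM('a)"
      using measure_lebesgue_affine[of "1/2" 0 \<Omega>] by (simp add: K_def N_def power_divide)
    finally show ?thesis .
  qed
  have T: "turan_fun \<Omega> x = of_real (2 ^ DIM('a) / N * g x)" for x
    unfolding turan_fun_def K_def[symmetric] convolve_indicator[OF \<open>K \<in> sets borel\<close>] g_def N_def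
    by simp
  have contg: "continuous_on UNIV g"
    unfolding g_def by (intro continuous_on_convolve_indicator K)
  have cont: "continuous_on UNIV (turan_fun \<Omega>)"
    unfolding T by (intro continuous_intros contg)
  then have [measurable]: "turan_fun \<Omega> \<in> borel_measurable borel"
    by (rule borel_measurable_continuous_onI)
  have supp: "supported_in (turan_fun \<Omega>) \<Omega>"
    unfolding supported_in_def
  proof (intro allI impI)
    fix x assume x: "x \<notin> \<Omega>"
    have "\<not> (y \<in> K \<and> x - y \<in> K)" for y
    proof
      assume "y \<in> K \<and> x - y \<in> K"
      then obtain a b where "a \<in> \<Omega>" "b \<in> \<Omega>" "y = (1/2) *\<^sub>R a" "x - y = (1/2) *\<^sub>R b"
        unfolding K_def by blast
      then have "(1/2) *\<^sub>R a + (1/2) *\<^sub>R b \<in> \<Omega>" "x = (1/2) *\<^sub>R a + (1/2) *\<^sub>R b"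
        using \<Omega>(4) by (auto simp: convex_def algebra_simps)
      with x show False by simp
    qed
    then have "g x = integral\<^sup>L lborel (\<lambda>y::'a. 0::real)"
      unfolding g_def by (intro Bochner_Integration.integral_cong) (auto simp: indicator_def)
    then show "turan_fun \<Omega> x = 0" by (simp add: T)
  qed
  have gle: "g x \<le> measure lborel K" for x
  proof -
    have i: "integrable lborel (indicator K :: 'a \<Rightarrow> real)"
      using emeasure_bounded_finite[OF K(2)] by (simp add: integrable_indicator_iff)
    have "g x \<le> (\<integral>y. indicator K y \<partial>lborel)"
      unfolding g_def using i
      by (intro integral_mono Bochner_Integration.integrable_bound[OF i]) (auto simp: indicator_def)
    then show ?thesis by simp
  qed
  have gnn: "g x \<ge> 0" for x
    unfolding g_def by (intro Bochner_Integration.integral_nonneg) auto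
  have "integrable lborel (turan_fun \<Omega>)"
  proof (rule integrable_bounded_support[OF _ _ \<Omega>(3)])
    show "cmod (turan_fun \<Omega> x) \<le> 1" for x
      unfolding T norm_of_real using gle[of x] gnn[of x] N by (simp add: MK field_simps)
  qed (use supp in \<open>auto simp: supported_in_def\<close>)
  then have int: "integrable lebesgue (turan_fun \<Omega>)"
    by (simp add: integrable_completion)
  have four: "fourier (turan_fun \<Omega>) \<xi>
      = of_real (2 ^ DIM('a) / N) * (\<integral>y. indicator K y * expfun (- \<xi>) y \<partial>lborel)\<^sup>2" for \<xi>
    unfolding fourier_convolve_indicator[OF \<open>K \<in> sets borel\<close> K(2), symmetric]
    by (simp add: fourier_lborel T g_def mult.assoc)
  \<comment> \<open>Conjugation changes the sign of the frequency, and the reflection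
    \<open>y \<mapsto> - y\<close>, under which \<open>K\<close> is invariant, changes it
    back.\<close>
  have realint: "(\<integral>y. indicator K y * expfun (- \<xi>) y \<partial>lborel) \<in> \<real>" for \<xi>
  proof -
    have "cnj (\<integral>y. indicator K y * expfun (- \<xi>) y \<partial>lborel)
        = (\<integral>y. cnj (indicator K y * expfun (- \<xi>) y) \<partial>lborel)"
      by (rule Bochner_Integration.integral_cnj[symmetric])
    also have "\<dots> = (\<integral>y. indicator K y * expfun \<xi> y \<partial>lborel)"
      by (intro Bochner_Integration.integral_cong) (auto simp: cnj_expfun indicator_def)
    also have "\<dots> = (\<integral>y. indicator K (0 + (-1) *\<^sub>R y) * expfun \<xi> (0 + (-1) *\<^sub>R y) \<partial>lborel)"
      by (subst lborel_integral_affine[where c = "-1" and t = 0]) (simp_all, measurable)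
    also have "\<dots> = (\<integral>y. indicator K y * expfun (- \<xi>) y \<partial>lborel)"
      by (simp add: indicator_uminus[OF symK] expfun_uminus)
    finally show ?thesis by (simp add: Reals_cnj_iff)
  qed
  have fnn: "fourier (turan_fun \<Omega>) \<xi> \<in> \<real>\<^sub>\<ge>\<^sub>0" for \<xi>
  proof -
    obtain r where "(\<integral>y. indicator K y * expfun (- \<xi>) y \<partial>lborel) = complex_of_real r"
      using realint[of \<xi>] by (auto elim: Reals_cases)
    then have "fourier (turan_fun \<Omega>) \<xi> = of_real (2 ^ DIM('a) / N * r\<^sup>2)"
      unfolding four by simp
    then show ?thesis
      using N by (simp only: nonneg_Reals_of_real_iff) auto
  qed
  \<comment> \<open>At \<open>0\<close> the two factors are \<open>indicator K y\<close> and
    \<open>indicator K (- y)\<close>, equal by symmetry.\<close>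
  have "g 0 = (\<integral>y. indicator K y \<partial>lborel)"
    unfolding g_def by (intro Bochner_Integration.integral_cong)
      (auto simp: indicator_uminus[OF symK] indicator_def symmetric_setD[OF symK])
  then have "turan_fun \<Omega> 0 = 1"
    unfolding T using N by (simp add: MK)
  with cont int fnn supp show "turan_admissible \<Omega> (turan_fun \<Omega>)"
    unfolding turan_admissible_def positive_definite_fun_def by blast
  have "(\<integral>x. turan_fun \<Omega> x \<partial>lebesgue) = fourier (turan_fun \<Omega>) 0"
    by (simp add: fourier_def)
  also have "\<dots> = of_real (2 ^ DIM('a) / N) * (\<integral>y. of_real (indicator K y) \<partial>lborel)\<^sup>2"
    unfolding four by (simp add: of_real_indicator)
  also have "\<dots> = of_real (2 ^ DIM('a) / N * (measure lborel K)\<^sup>2)"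
    by (subst integral_complex_of_real) simp
  also have "\<dots> = of_real (N / 2 ^ DIM('a))"
    unfolding MK using N by (simp add: power2_eq_square)
  finally show "(\<integral>x. turan_fun \<Omega> x \<partial>lebesgue) = of_real (measure lebesgue \<Omega> / 2 ^ DIM('a))"
    by (simp add: N_def)
qed

end

section \<open>Orthogonal bases of \<open>L\<^sup>2(\<Omega>)\<close>\<close>

lemma L2_iff_lborel:
  assumes "open \<Omega>" "f \<in> borel_measurable borel"
  shows "f \<in> L2 \<Omega> \<longleftrightarrow> integrable lborel (\<lambda>x. indicator \<Omega> x *\<^sub>R (cmod (f x))\<^sup>2)"
proof -
  have [measurable]: "f \<in> borel_measurable borel" "\<Omega> \<in> sets borel" using assms by auto
  have "f \<in> borel_measurable (lebesgue_on \<Omega>)"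
    by (intro measurable_restrict_space1 measurable_completion) simp
  then show ?thesis
    unfolding L2_def using assms(1)
    by (simp add: integrable_restrict_space integrable_completion)
qed

lemma L2_bounded:
  assumes "open \<Omega>" "bounded \<Omega>" "f \<in> borel_measurable borel" "\<And>x. cmod (f x) \<le> B"
  shows "f \<in> L2 \<Omega>"
proof -
  have [measurable]: "f \<in> borel_measurable borel" "\<Omega> \<in> sets borel" using assms by auto
  have "integrable lborel (\<lambda>x. indicator \<Omega> x *\<^sub>R (cmod (f x))\<^sup>2)"
    by (rule integrable_bounded_support[where B = "B\<^sup>2" and S = \<Omega>])
      (use assms in \<open>auto simp: indicator_def intro!: power_mono\<close>)
  then show ?thesis using L2_iff_lborel assms by blast
qed

lemma borel_measurable_cnj [measurable]: "cnj \<in> borel_measurable borel"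
  by (intro borel_measurable_continuous_onI continuous_intros)

lemma L2_inner_integrable:
  assumes "f \<in> L2 \<Omega>" "g \<in> L2 \<Omega>"
  shows "integrable (lebesgue_on \<Omega>) (\<lambda>x. f x * cnj (g x))"
proof (rule Bochner_Integration.integrable_bound)
  show "integrable (lebesgue_on \<Omega>) (\<lambda>x. (cmod (f x))\<^sup>2 + (cmod (g x))\<^sup>2)"
    using assms unfolding L2_def by auto
  have [measurable]: "f \<in> borel_measurable (lebesgue_on \<Omega>)" "g \<in> borel_measurable (lebesgue_on \<Omega>)"
    using assms unfolding L2_def by auto
  show "(\<lambda>x. f x * cnj (g x)) \<in> borel_measurable (lebesgue_on \<Omega>)"
    by measurable
  have "a * b \<le> a\<^sup>2 + b\<^sup>2" for a b :: real
    using sum_squares_bound[of a b] sum_squares_bound[of a "-b"] by (auto simp: algebra_simps)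
  then show "AE x in lebesgue_on \<Omega>. norm (f x * cnj (g x)) \<le> norm ((cmod (f x))\<^sup>2 + (cmod (g x))\<^sup>2)"
    by (auto simp: norm_mult)
qed

lemma L2_mult: "f \<in> L2 \<Omega> \<Longrightarrow> (\<lambda>x. c * f x) \<in> L2 \<Omega>"
  unfolding L2_def by (auto simp: norm_mult power_mult_distrib)

lemma L2_add:
  assumes "f \<in> L2 \<Omega>" "g \<in> L2 \<Omega>"
  shows "(\<lambda>x. f x + g x) \<in> L2 \<Omega>"
proof -
  have m [measurable]: "f \<in> borel_measurable (lebesgue_on \<Omega>)" "g \<in> borel_measurable (lebesgue_on \<Omega>)"
    using assms unfolding L2_def by auto
  have "integrable (lebesgue_on \<Omega>) (\<lambda>x. (cmod (f x + g x))\<^sup>2)"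
  proof (rule Bochner_Integration.integrable_bound)
    show "integrable (lebesgue_on \<Omega>) (\<lambda>x. 2 * (cmod (f x))\<^sup>2 + 2 * (cmod (g x))\<^sup>2)"
      using assms unfolding L2_def by auto
    have "(cmod (a + b))\<^sup>2 \<le> 2 * (cmod a)\<^sup>2 + 2 * (cmod b)\<^sup>2" for a b
    proof -
      have "(cmod (a + b))\<^sup>2 \<le> (cmod a + cmod b)\<^sup>2"
        by (intro power_mono norm_triangle_ineq) auto
      also have "\<dots> \<le> 2 * (cmod a)\<^sup>2 + 2 * (cmod b)\<^sup>2"
        using sum_squares_bound[of "cmod a" "cmod b"] by (simp add: power2_sum)
      finally show ?thesis .
    qed
    then show "AE x in lebesgue_on \<Omega>. norm ((cmod (f x + g x))\<^sup>2) \<le> norm (2 * (cmod (f x))\<^sup>2 + 2 * (cmod (g x))\<^sup>2)"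
      by auto
  qed simp
  then show ?thesis unfolding L2_def by simp
qed

lemma L2_diff: "f \<in> L2 \<Omega> \<Longrightarrow> g \<in> L2 \<Omega> \<Longrightarrow> (\<lambda>x. f x - g x) \<in> L2 \<Omega>"
  using L2_add[of f \<Omega> "\<lambda>x. (-1) * g x"] L2_mult[of g \<Omega> "-1"] by simp

lemma L2_sum: "finite A \<Longrightarrow> (\<And>i. i \<in> A \<Longrightarrow> f i \<in> L2 \<Omega>) \<Longrightarrow> (\<lambda>x. \<Sum>i\<in>A. f i x) \<in> L2 \<Omega>"
proof (induction A rule: finite_induct)
  case empty
  then show ?case by (simp add: L2_def)
next
  case (insert i A)
  then show ?case using L2_add[of "f i" \<Omega> "\<lambda>x. \<Sum>i\<in>A. f i x"] by simp
qed

lemma L2_inner_cnj: "cnj (L2_inner \<Omega> f g) = L2_inner \<Omega> g f"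
proof -
  have "cnj (L2_inner \<Omega> f g) = (\<integral>x. cnj (f x * cnj (g x)) \<partial>lebesgue_on \<Omega>)"
    unfolding L2_inner_def by (rule Bochner_Integration.integral_cnj[symmetric])
  then show ?thesis by (simp add: L2_inner_def mult.commute)
qed

lemma L2_inner_self: "L2_inner \<Omega> f f = of_real ((L2_norm \<Omega> f)\<^sup>2)"
proof -
  have "L2_inner \<Omega> f f = (\<integral>x. of_real ((cmod (f x))\<^sup>2) \<partial>lebesgue_on \<Omega>)"
    unfolding L2_inner_def by (simp only: complex_norm_square)
  then show ?thesis
    unfolding L2_norm_def integral_complex_of_real
    by (subst real_sqrt_pow2) auto
qed

lemma L2_inner_add_left:
  assumes "f \<in> L2 \<Omega>" "g \<in> L2 \<Omega>" "h \<in> L2 \<Omega>"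
  shows "L2_inner \<Omega> (\<lambda>x. f x + g x) h = L2_inner \<Omega> f h + L2_inner \<Omega> g h"
  unfolding L2_inner_def
  by (simp add: distrib_right Bochner_Integration.integral_add L2_inner_integrable assms)

lemma L2_inner_mult_left: "L2_inner \<Omega> (\<lambda>x. c * f x) h = c * L2_inner \<Omega> f h"
  unfolding L2_inner_def by (simp add: mult.assoc)

lemma L2_inner_diff_left:
  assumes "f \<in> L2 \<Omega>" "g \<in> L2 \<Omega>" "h \<in> L2 \<Omega>"
  shows "L2_inner \<Omega> (\<lambda>x. f x - g x) h = L2_inner \<Omega> f h - L2_inner \<Omega> g h"
  unfolding L2_inner_def
  by (simp add: left_diff_distrib Bochner_Integration.integral_diff L2_inner_integrable assms)

lemma L2_inner_sum_left:
  assumes "finite A" "\<And>i. i \<in> A \<Longrightarrow> f i \<in> L2 \<Omega>" "h \<in> L2 \<Omega>"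
  shows "L2_inner \<Omega> (\<lambda>x. \<Sum>i\<in>A. c i * f i x) h = (\<Sum>i\<in>A. c i * L2_inner \<Omega> (f i) h)"
  using assms
proof (induction A rule: finite_induct)
  case empty
  then show ?case by (simp add: L2_inner_def)
next
  case (insert i A)
  then show ?case
    using L2_inner_add_left[of "\<lambda>x. c i * f i x" \<Omega> "\<lambda>x. \<Sum>i\<in>A. c i * f i x" h]
    by (simp add: L2_mult L2_sum L2_inner_mult_left)
qed

text \<open>A weighted form of Cauchy-Schwarz, from integrating
  \<open>(t * cmod (f x) - cmod (g x))\<^sup>2 / t \<ge> 0\<close>. The free weight \<open>t\<close>
  trades a small \<open>f\<close> against a fixed \<open>g\<close> without dividing by norms that
  may vanish.\<close>

lemma norm_L2_inner_le:
  assumes "f \<in> L2 \<Omega>" "g \<in> L2 \<Omega>" "t > 0"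
  shows "2 * cmod (L2_inner \<Omega> f g) \<le> t * (L2_norm \<Omega> f)\<^sup>2 + (L2_norm \<Omega> g)\<^sup>2 / t"
proof -
  have sq: "(L2_norm \<Omega> h)\<^sup>2 = (\<integral>x. (cmod (h x))\<^sup>2 \<partial>lebesgue_on \<Omega>)" for h
    unfolding L2_norm_def by (subst real_sqrt_pow2) auto
  have i: "integrable (lebesgue_on \<Omega>) (\<lambda>x. (cmod (h x))\<^sup>2)" if "h \<in> L2 \<Omega>" for h
    using that unfolding L2_def by auto
  have "2 * cmod (L2_inner \<Omega> f g) \<le> 2 * (\<integral>x. cmod (f x * cnj (g x)) \<partial>lebesgue_on \<Omega>)"
    unfolding L2_inner_def by simp
  also have "\<dots> = (\<integral>x. 2 * cmod (f x * cnj (g x)) \<partial>lebesgue_on \<Omega>)"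
    by simp
  also have "\<dots> \<le> (\<integral>x. t * (cmod (f x))\<^sup>2 + (cmod (g x))\<^sup>2 / t \<partial>lebesgue_on \<Omega>)"
  proof (rule integral_mono)
    show "integrable (lebesgue_on \<Omega>) (\<lambda>x. 2 * cmod (f x * cnj (g x)))"
      by (intro integrable_mult_right integrable_norm L2_inner_integrable assms)
    show "integrable (lebesgue_on \<Omega>) (\<lambda>x. t * (cmod (f x))\<^sup>2 + (cmod (g x))\<^sup>2 / t)"
      by (intro Bochner_Integration.integrable_add integrable_mult_right integrable_divide_zero i assms)
    fix x
    have "0 \<le> (t * cmod (f x) - cmod (g x))\<^sup>2 / t"
      using assms(3) by simp
    also have "\<dots> = t * (cmod (f x))\<^sup>2 + (cmod (g x))\<^sup>2 / t - 2 * cmod (f x) * cmod (g x)"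
      using assms(3) by (simp add: power2_eq_square field_simps)
    finally show "2 * cmod (f x * cnj (g x)) \<le> t * (cmod (f x))\<^sup>2 + (cmod (g x))\<^sup>2 / t"
      by (simp add: norm_mult)
  qed
  also have "\<dots> = t * (L2_norm \<Omega> f)\<^sup>2 + (L2_norm \<Omega> g)\<^sup>2 / t"
    unfolding sq by (subst Bochner_Integration.integral_add) (use assms i in auto)
  finally show ?thesis .
qed

text \<open>Convergence of the sum comes from the best-approximation property of orthogonal projections
  onto finite spans and the density of the span.\<close>

lemma parseval_orthogonal_basis:
  assumes E: "orthogonal_basis_L2 \<Omega> E" and N: "\<And>u. u \<in> E \<Longrightarrow> (L2_norm \<Omega> u)\<^sup>2 = N" "N > 0"
    and h: "h \<in> L2 \<Omega>" and k: "k \<in> L2 \<Omega>"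
  shows "((\<lambda>u. L2_inner \<Omega> h u * L2_inner \<Omega> u k) has_sum of_real N * L2_inner \<Omega> h k) E"
proof -
  \<comment> \<open>The orthogonal projection of \<open>h\<close> onto the span of \<open>L\<close>;
    all basis vectors have the same squared norm \<open>N\<close>, hence the common
    denominator.\<close>
  define P where "P L x = (\<Sum>u\<in>L. (L2_inner \<Omega> h u / of_real N) * u x)" for L x
  have EL: "u \<in> L2 \<Omega>" if "u \<in> E" for u
    using E that unfolding orthogonal_basis_L2_def by blast
  have ort: "L2_inner \<Omega> u v = (if u = v then of_real N else 0)" if "u \<in> E" "v \<in> E" for u v
    using E that N(1)[of v] unfolding orthogonal_basis_L2_def by (auto simp: L2_inner_self)
  have PL: "P L \<in> L2 \<Omega>" if "finite L" "L \<subseteq> E" for L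
    unfolding P_def using that by (intro L2_sum L2_mult EL) auto
  have PLk: "of_real N * L2_inner \<Omega> (P L) k = (\<Sum>u\<in>L. L2_inner \<Omega> h u * L2_inner \<Omega> u k)"
    if "finite L" "L \<subseteq> E" for L
    using that N(2) unfolding P_def by (subst L2_inner_sum_left) (auto simp: EL k sum_distrib_left subset_iff)
  have orth: "L2_inner \<Omega> (\<lambda>x. h x - P L x) v = 0" if L: "finite L" "L \<subseteq> E" and v: "v \<in> L" for L v
  proof -
    have "L2_inner \<Omega> (P L) v = (\<Sum>u\<in>L. (L2_inner \<Omega> h u / of_real N) * L2_inner \<Omega> u v)"
      unfolding P_def using L v by (subst L2_inner_sum_left) (auto simp: EL subset_iff)
    also have "\<dots> = (\<Sum>u\<in>L. if u = v then L2_inner \<Omega> h v else 0)"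
      using L v N(2) by (intro sum.cong) (auto simp: ort subset_iff)
    also have "\<dots> = L2_inner \<Omega> h v" using L v by simp
    finally show ?thesis
      using L v by (subst L2_inner_diff_left) (auto simp: h PL EL subset_iff)
  qed
  \<comment> \<open>The error of any other combination is the residual \<open>a\<close> plus a
    vector \<open>b\<close> of the span of \<open>L\<close>. These are orthogonal, so Pythagoras
    applies.\<close>
  have best: "(L2_norm \<Omega> (\<lambda>x. h x - P L x))\<^sup>2 \<le> (L2_norm \<Omega> (\<lambda>x. h x - (\<Sum>u\<in>L. c u * u x)))\<^sup>2"
    if L: "finite L" "L \<subseteq> E" for L c
  proof -
    define a where "a x = h x - P L x" for x
    define b where "b x = (\<Sum>u\<in>L. (L2_inner \<Omega> h u / of_real N - c u) * u x)" for x
    have ab: "h x - (\<Sum>u\<in>L. c u * u x) = a x + b x" for x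
      unfolding a_def b_def P_def by (simp add: left_diff_distrib sum_subtractf)
    have aL: "a \<in> L2 \<Omega>" unfolding a_def by (intro L2_diff h PL L)
    have bL: "b \<in> L2 \<Omega>" unfolding b_def using L by (intro L2_sum L2_mult EL) auto
    have abL: "(\<lambda>x. a x + b x) \<in> L2 \<Omega>" by (intro L2_add aL bL)
    have ba: "L2_inner \<Omega> b a = 0"
    proof -
      have "L2_inner \<Omega> u a = 0" if "u \<in> L" for u
        using orth[OF L that] L2_inner_cnj[of \<Omega> a u] unfolding a_def[symmetric, abs_def] by simp
      then show ?thesis
        unfolding b_def using L aL by (subst L2_inner_sum_left) (auto simp: EL subset_iff)
    qed
    have ab0: "L2_inner \<Omega> a b = 0"
      using ba L2_inner_cnj[of \<Omega> b a] by simp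
    have "L2_inner \<Omega> (\<lambda>x. a x + b x) (\<lambda>x. a x + b x)
        = L2_inner \<Omega> a (\<lambda>x. a x + b x) + L2_inner \<Omega> b (\<lambda>x. a x + b x)"
      by (rule L2_inner_add_left[OF aL bL abL])
    also have "\<dots> = cnj (L2_inner \<Omega> (\<lambda>x. a x + b x) a) + cnj (L2_inner \<Omega> (\<lambda>x. a x + b x) b)"
      by (simp only: L2_inner_cnj)
    also have "\<dots> = L2_inner \<Omega> a a + L2_inner \<Omega> b b"
      using ba ab0 by (simp add: L2_inner_add_left aL bL L2_inner_cnj)
    finally have "complex_of_real ((L2_norm \<Omega> (\<lambda>x. a x + b x))\<^sup>2)
        = of_real ((L2_norm \<Omega> a)\<^sup>2 + (L2_norm \<Omega> b)\<^sup>2)"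
      by (simp add: L2_inner_self)
    then have "(L2_norm \<Omega> (\<lambda>x. a x + b x))\<^sup>2 = (L2_norm \<Omega> a)\<^sup>2 + (L2_norm \<Omega> b)\<^sup>2"
      by (simp only: of_real_eq_iff)
    then show ?thesis unfolding ab a_def[symmetric, abs_def] by simp
  qed
  show ?thesis
    unfolding has_sum_def tendsto_iff eventually_finite_subsets_at_top
  proof (intro allI impI)
    fix e :: real assume e: "e > 0"
    \<comment> \<open>Chosen so that the final error is at most \<open>e / 2\<close>; the summand 1
      keeps the denominator positive when \<open>k\<close> has norm zero.\<close>
    define \<epsilon> where "\<epsilon> = e / (N * (1 + (L2_norm \<Omega> k)\<^sup>2))"
    have pos: "1 + (L2_norm \<Omega> k)\<^sup>2 > 0" by (simp add: add_pos_nonneg)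
    then have \<epsilon>: "\<epsilon> > 0" using e N(2) by (simp add: \<epsilon>_def)
    obtain F c where F: "finite F" "F \<subseteq> E" "L2_norm \<Omega> (\<lambda>x. h x - (\<Sum>u\<in>F. c u * u x)) < \<epsilon>"
      using E h \<epsilon> unfolding orthogonal_basis_L2_def by blast
    show "\<exists>X. finite X \<and> X \<subseteq> E \<and> (\<forall>Y. finite Y \<and> X \<subseteq> Y \<and> Y \<subseteq> E \<longrightarrow>
        dist (\<Sum>u\<in>Y. L2_inner \<Omega> h u * L2_inner \<Omega> u k) (of_real N * L2_inner \<Omega> h k) < e)"
    proof (intro exI[of _ F] conjI allI impI F; elim conjE)
      fix L assume L: "finite L" "F \<subseteq> L" "L \<subseteq> E"
      \<comment> \<open>Padding with zero coefficients turns the approximation over \<open>F\<close>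
        into one over the larger \<open>L\<close>, so the projection onto every such
        \<open>L\<close> is at least as good.\<close>
      have LF: "(\<Sum>u\<in>L. (if u \<in> F then c u else 0) * u x) = (\<Sum>u\<in>F. c u * u x)" for x
        using L by (intro sum.mono_neutral_cong_right) auto
      have "L2_norm \<Omega> (\<lambda>x. h x - (\<Sum>u\<in>F. c u * u x)) \<ge> 0"
        by (simp add: L2_norm_def)
      then have "(L2_norm \<Omega> (\<lambda>x. h x - (\<Sum>u\<in>F. c u * u x)))\<^sup>2 \<le> \<epsilon>\<^sup>2"
        using F(3) by (intro power_mono) auto
      with best[OF L(1,3), of "\<lambda>u. if u \<in> F then c u else 0"]
      have le: "(L2_norm \<Omega> (\<lambda>x. h x - P L x))\<^sup>2 \<le> \<epsilon>\<^sup>2"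
        unfolding LF by (rule order_trans)
      have "(\<Sum>u\<in>L. L2_inner \<Omega> h u * L2_inner \<Omega> u k) - of_real N * L2_inner \<Omega> h k
          = - (of_real N * L2_inner \<Omega> (\<lambda>x. h x - P L x) k)"
        unfolding PLk[OF L(1,3), symmetric] L2_inner_diff_left[OF h PL[OF L(1,3)] k]
        by (simp add: right_diff_distrib)
      then have "dist (\<Sum>u\<in>L. L2_inner \<Omega> h u * L2_inner \<Omega> u k) (of_real N * L2_inner \<Omega> h k)
          = N * cmod (L2_inner \<Omega> (\<lambda>x. h x - P L x) k)"
        unfolding dist_norm using N(2) by (simp add: norm_mult)
      moreover have "2 * cmod (L2_inner \<Omega> (\<lambda>x. h x - P L x) k) \<le> \<epsilon> * (1 + (L2_norm \<Omega> k)\<^sup>2)"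
      proof -
        \<comment> \<open>With weight \<open>1 / \<epsilon>\<close>, the squared residual, at most
          \<open>\<epsilon>\<^sup>2\<close>, contributes \<open>\<epsilon>\<close>, and
          \<open>k\<close> contributes \<open>\<epsilon>\<close> times its squared norm.\<close>
        have "2 * cmod (L2_inner \<Omega> (\<lambda>x. h x - P L x) k)
            \<le> (1 / \<epsilon>) * (L2_norm \<Omega> (\<lambda>x. h x - P L x))\<^sup>2 + (L2_norm \<Omega> k)\<^sup>2 / (1 / \<epsilon>)"
          using \<epsilon> L by (intro norm_L2_inner_le L2_diff h k PL) auto
        also have "\<dots> \<le> (1 / \<epsilon>) * \<epsilon>\<^sup>2 + (L2_norm \<Omega> k)\<^sup>2 / (1 / \<epsilon>)"
          using \<epsilon> le by (intro add_right_mono mult_left_mono) auto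
        also have "\<dots> = \<epsilon> * (1 + (L2_norm \<Omega> k)\<^sup>2)"
          using \<epsilon> by (simp add: power2_eq_square algebra_simps)
        finally show ?thesis .
      qed
      then have "N * (2 * cmod (L2_inner \<Omega> (\<lambda>x. h x - P L x) k)) \<le> N * (\<epsilon> * (1 + (L2_norm \<Omega> k)\<^sup>2))"
        using N(2) by (intro mult_left_mono) auto
      moreover have "N * (\<epsilon> * (1 + (L2_norm \<Omega> k)\<^sup>2)) = e"
        using pos N(2) by (simp add: \<epsilon>_def)
      ultimately show "dist (\<Sum>u\<in>L. L2_inner \<Omega> h u * L2_inner \<Omega> u k) (of_real N * L2_inner \<Omega> h k) < e"
        using e by linarith
    qed
  qed
qed

section \<open>Tiling by translates of a Fourier transform\<close>

text \<open>Only the product has to vanish outside \<open>\<Omega>\<close>, so one of the two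
  functions may be an exponential on the whole space.\<close>

lemma L2_inner_lborel:
  assumes "open \<Omega>" "f \<in> borel_measurable borel" "g \<in> borel_measurable borel"
    and "\<And>x. x \<notin> \<Omega> \<Longrightarrow> f x * cnj (g x) = 0"
  shows "L2_inner \<Omega> f g = (\<integral>x. f x * cnj (g x) \<partial>lborel)"
proof -
  have [measurable]: "f \<in> borel_measurable borel" "g \<in> borel_measurable borel" "\<Omega> \<in> sets borel"
    using assms by auto
  have "L2_inner \<Omega> f g = (\<integral>x. indicator \<Omega> x *\<^sub>R (f x * cnj (g x)) \<partial>lebesgue)"
    unfolding L2_inner_def using assms(1) by (intro integral_restrict_space) auto
  also have "\<dots> = (\<integral>x. f x * cnj (g x) \<partial>lebesgue)"
    by (intro Bochner_Integration.integral_cong) (use assms(4) in \<open>auto simp: indicator_def\<close>)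
  also have "\<dots> = (\<integral>x. f x * cnj (g x) \<partial>lborel)"
    by (intro integral_completion) measurable
  finally show ?thesis .
qed

locale spectral_basis =
  fixes \<Omega> :: "'a::euclidean_space set" and \<Lambda> :: "'a set"
  assumes open_dom: "open \<Omega>" and bounded_dom: "bounded \<Omega>" and nonempty_dom: "\<Omega> \<noteq> {}"
    and basis: "orthogonal_basis_L2 \<Omega> (expfun ` \<Lambda>)"
begin

lemma measure_pos: "measure lebesgue \<Omega> > 0"
  by (rule measure_lebesgue_open_pos[OF open_dom bounded_dom nonempty_dom])

text \<open>Exponentials have modulus one, so each has squared norm equal to the measure of
  \<open>\<Omega>\<close>. The sum is indexed by the exponentials themselves, as in
  \<open>orthogonal_basis_L2\<close>.\<close>

lemma parseval_exponentials:
  assumes "h \<in> L2 \<Omega>" "k \<in> L2 \<Omega>"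
  shows "((\<lambda>u. L2_inner \<Omega> h u * L2_inner \<Omega> u k) has_sum
    of_real (measure lebesgue \<Omega>) * L2_inner \<Omega> h k) (expfun ` \<Lambda>)"
proof (rule parseval_orthogonal_basis[OF basis _ measure_pos assms])
  fix u assume "u \<in> expfun ` \<Lambda>"
  then have "(L2_norm \<Omega> u)\<^sup>2 = (\<integral>x. 1 \<partial>lebesgue_on \<Omega>)"
    unfolding L2_norm_def by (subst real_sqrt_pow2) auto
  also have "\<dots> = measure lebesgue \<Omega>"
    using lmeasurable_open[OF bounded_dom open_dom]
    by (simp add: measure_restrict_space space_restrict_space)
  finally show "(L2_norm \<Omega> u)\<^sup>2 = measure lebesgue \<Omega>" .
qed

text \<open>Translating both \<open>H\<close> and \<open>\<psi>\<close> by \<open>- z/2\<close> moves the supports into \<open>\<Omega>\<close>, and the phases that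
  this produces cancel in the product of the two Fourier coefficients.\<close>

lemma tiling_small_support:
  fixes H \<psi> :: "'a \<Rightarrow> complex"
  assumes mH: "H \<in> borel_measurable borel" and m\<psi>: "\<psi> \<in> borel_measurable borel"
    and bH: "\<And>x. cmod (H x) \<le> BH" and b\<psi>: "\<And>x. cmod (\<psi> x) \<le> B\<psi>"
    and sH: "\<And>x. x \<notin> ball z r \<Longrightarrow> H x = 0" and s\<psi>: "\<And>x. x \<notin> ball 0 r \<Longrightarrow> \<psi> x = 0"
    and z: "ball ((1/2) *\<^sub>R z) r \<subseteq> \<Omega>" "ball (- ((1/2) *\<^sub>R z)) r \<subseteq> \<Omega>"
  shows "((\<lambda>u. (\<integral>x. H x * (expfun a x * cnj (u x)) \<partial>lborel) * (\<integral>x. \<psi> x * (cnj (expfun a x) * u x) \<partial>lborel))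
    has_sum of_real (measure lebesgue \<Omega>) * (\<integral>x. H x * \<psi> x \<partial>lborel)) (expfun ` \<Lambda>)"
proof -
  note [measurable] = mH m\<psi>
  define w where "w = (1/2) *\<^sub>R z"
  have zw: "z = w + w" by (simp add: w_def flip: scaleR_add_left)
  \<comment> \<open>Modulating by \<open>expfun a\<close> shifts all frequencies by
    \<open>a\<close>. In \<open>k\<close> the function \<open>\<psi>\<close> is conjugated because
    the inner product conjugates its second argument, so that \<open>h x * cnj (k x)\<close> is
    \<open>H (w + x) * \<psi> (w + x)\<close>.\<close>
  define h where "h x = H (w + x) * expfun a x" for x
  define k where "k x = cnj (\<psi> (w + x)) * expfun a x" for x
  have [measurable]: "h \<in> borel_measurable borel" unfolding h_def by measurable
  have [measurable]: "k \<in> borel_measurable borel" unfolding k_def by measurable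
  have h0: "h x = 0" if "x \<notin> \<Omega>" for x
  proof -
    have "x \<notin> ball w r" using that z(1) by (auto simp: w_def)
    then have "w + x \<notin> ball z r" by (simp add: zw dist_norm)
    then show ?thesis by (simp add: h_def sH)
  qed
  have k0: "k x = 0" if "x \<notin> \<Omega>" for x
  proof -
    have "x \<notin> ball (- w) r" using that z(2) by (auto simp: w_def)
    then have "w + x \<notin> ball 0 r" by (simp add: dist_norm norm_minus_commute)
    then show ?thesis by (simp add: k_def s\<psi>)
  qed
  have hk: "h \<in> L2 \<Omega>" "k \<in> L2 \<Omega>"
    by (rule L2_bounded[OF open_dom bounded_dom, of _ BH] L2_bounded[OF open_dom bounded_dom, of _ B\<psi>];
        simp add: h_def k_def norm_mult bH b\<psi>; measurable)+
  have shift: "(\<integral>x. F x \<partial>lborel) = (\<integral>x. F (w + x) \<partial>lborel)"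
    if "F \<in> borel_measurable borel" for F :: "'a \<Rightarrow> complex"
    using lborel_integral_affine[OF that, of 1 w] by simp
  have "L2_inner \<Omega> h k = (\<integral>x. h x * cnj (k x) \<partial>lborel)"
    by (rule L2_inner_lborel) (auto simp: open_dom h0)
  also have "\<dots> = (\<integral>x. H (w + x) * \<psi> (w + x) \<partial>lborel)"
    by (intro Bochner_Integration.integral_cong)
      (auto simp: h_def k_def cnj_expfun algebra_simps simp flip: expfun_add_left)
  also have "\<dots> = (\<integral>x. H x * \<psi> x \<partial>lborel)"
    by (rule shift[symmetric]) measurable
  finally have inner_hk: "L2_inner \<Omega> h k = (\<integral>x. H x * \<psi> x \<partial>lborel)" .
  have "L2_inner \<Omega> h u * L2_inner \<Omega> u k =
      (\<integral>x. H x * (expfun a x * cnj (u x)) \<partial>lborel) * (\<integral>x. \<psi> x * (cnj (expfun a x) * u x) \<partial>lborel)"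
    if "u \<in> expfun ` \<Lambda>" for u
  proof -
    from that obtain b where u: "u = expfun b" by auto
    have 1: "(\<integral>x. H x * (expfun a x * cnj (u x)) \<partial>lborel) = expfun (a - b) w * L2_inner \<Omega> h u"
    proof -
      have "(\<integral>x. H x * (expfun a x * cnj (u x)) \<partial>lborel)
          = (\<integral>x. H (w + x) * (expfun a (w + x) * cnj (u (w + x))) \<partial>lborel)"
        unfolding u by (rule shift) measurable
      also have "\<dots> = (\<integral>x. expfun (a - b) w * (h x * cnj (u x)) \<partial>lborel)"
        by (intro Bochner_Integration.integral_cong)
          (auto simp: h_def u cnj_expfun expfun_add_right expfun_add_left[of a "- b", simplified] mult_ac)
      also have "\<dots> = expfun (a - b) w * L2_inner \<Omega> h u"
        by (subst L2_inner_lborel) (auto simp: open_dom h0 u)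
      finally show ?thesis .
    qed
    have 2: "(\<integral>x. \<psi> x * (cnj (expfun a x) * u x) \<partial>lborel) = expfun (b - a) w * L2_inner \<Omega> u k"
    proof -
      have "(\<integral>x. \<psi> x * (cnj (expfun a x) * u x) \<partial>lborel)
          = (\<integral>x. \<psi> (w + x) * (cnj (expfun a (w + x)) * u (w + x)) \<partial>lborel)"
        unfolding u by (rule shift) measurable
      also have "\<dots> = (\<integral>x. expfun (b - a) w * (u x * cnj (k x)) \<partial>lborel)"
        by (intro Bochner_Integration.integral_cong)
          (auto simp: k_def u cnj_expfun expfun_add_right expfun_add_left[of b "- a", simplified] mult_ac)
      also have "\<dots> = expfun (b - a) w * L2_inner \<Omega> u k"
        by (subst L2_inner_lborel) (auto simp: open_dom k0 u)
      finally show ?thesis .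
    qed
    have "expfun (a - b) w * expfun (b - a) w = 1"
      by (simp flip: expfun_add_left)
    then show ?thesis unfolding 1 2 by (simp add: mult_ac)
  qed
  with parseval_exponentials[OF hk] show ?thesis
    unfolding inner_hk by (simp cong: has_sum_cong)
qed

text \<open>Both sides are linear in \<open>H\<close>. Induction on the cover cuts off the part
  \<open>H1\<close> in one ball, which has small support, and leaves the rest \<open>H2\<close> to
  the remaining balls; hence \<open>H\<close> is generalized.\<close>

lemma tiling_finite_cover:
  fixes H \<psi> :: "'a \<Rightarrow> complex"
  assumes "finite Z"
    and m\<psi>: "\<psi> \<in> borel_measurable borel" and b\<psi>: "\<And>x. cmod (\<psi> x) \<le> B\<psi>"
    and s\<psi>: "\<And>x. x \<notin> ball 0 r \<Longrightarrow> \<psi> x = 0"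
    and Z: "\<And>z. z \<in> Z \<Longrightarrow> ball ((1/2) *\<^sub>R z) r \<subseteq> \<Omega> \<and> ball (- ((1/2) *\<^sub>R z)) r \<subseteq> \<Omega>"
    and "H \<in> borel_measurable borel" "\<And>x. cmod (H x) \<le> BH"
    and "\<And>x. x \<notin> (\<Union>z\<in>Z. ball z r) \<Longrightarrow> H x = 0"
  shows "((\<lambda>u. (\<integral>x. H x * (expfun a x * cnj (u x)) \<partial>lborel) * (\<integral>x. \<psi> x * (cnj (expfun a x) * u x) \<partial>lborel))
    has_sum of_real (measure lebesgue \<Omega>) * (\<integral>x. H x * \<psi> x \<partial>lborel)) (expfun ` \<Lambda>)"
  using assms(1) Z assms(6-)
proof (induction Z arbitrary: H rule: finite_induct)
  case empty
  then have "H = (\<lambda>x. 0)" by auto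
  then show ?case by simp
next
  case (insert z Z)
  note [measurable] = insert.prems(2) m\<psi>
  define H1 where "H1 x = indicator (ball z r) x * H x" for x
  define H2 where "H2 x = indicator (- ball z r) x * H x" for x
  have [measurable]: "H1 \<in> borel_measurable borel" "H2 \<in> borel_measurable borel"
    unfolding H1_def H2_def by (measurable; simp)+
  have BH: "BH \<ge> 0" using insert.prems(3) norm_ge_zero order_trans by blast
  have H12: "H x = H1 x + H2 x" for x by (auto simp: H1_def H2_def indicator_def)
  have b1: "cmod (H1 x) \<le> BH" and b2: "cmod (H2 x) \<le> BH" for x
    using insert.prems(3)[of x] BH by (auto simp: H1_def H2_def indicator_def)
  have s1: "x \<notin> ball z r \<Longrightarrow> H1 x = 0" for x by (simp add: H1_def)
  have s2: "x \<notin> (\<Union>z\<in>Z. ball z r) \<Longrightarrow> H2 x = 0" for x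
    using insert.prems(4)[of x] by (auto simp: H2_def indicator_def)
  \<comment> \<open>Bounded functions with bounded support are integrable, so the integral is
    additive here. \<open>g\<close> will be a product of exponentials, with bound 1, or
    \<open>\<psi>\<close>.\<close>
  have add: "(\<integral>x. H x * g x \<partial>lborel) = (\<integral>x. H1 x * g x \<partial>lborel) + (\<integral>x. H2 x * g x \<partial>lborel)"
    if [measurable]: "g \<in> borel_measurable borel" and g: "\<And>x. cmod (g x) \<le> B" for g B
  proof -
    have B: "B \<ge> 0" using g norm_ge_zero order_trans by blast
    have "integrable lborel (\<lambda>x. H1 x * g x)"
    proof (rule integrable_bounded_support[where B = "BH * B"])
      show "cmod (H1 x * g x) \<le> BH * B" for x
        unfolding norm_mult by (intro mult_mono b1 g BH norm_ge_zero)
      show "bounded (ball z r)" by simp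
    qed (measurable, simp add: s1)
    moreover have "integrable lborel (\<lambda>x. H2 x * g x)"
    proof (rule integrable_bounded_support[where B = "BH * B"])
      show "cmod (H2 x * g x) \<le> BH * B" for x
        unfolding norm_mult by (intro mult_mono b2 g BH norm_ge_zero)
      show "bounded (\<Union>z\<in>Z. ball z r)" using insert.hyps(1) by (intro bounded_UN) auto
    qed (measurable, simp add: s2)
    ultimately show ?thesis by (simp add: H12 distrib_right)
  qed
  have 1: "((\<lambda>u. (\<integral>x. H1 x * (expfun a x * cnj (u x)) \<partial>lborel) * (\<integral>x. \<psi> x * (cnj (expfun a x) * u x) \<partial>lborel))
    has_sum of_real (measure lebesgue \<Omega>) * (\<integral>x. H1 x * \<psi> x \<partial>lborel)) (expfun ` \<Lambda>)"
    by (rule tiling_small_support[OF _ m\<psi> b1 b\<psi> s1 s\<psi>]) (use insert.prems(1)[of z] in auto)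
  have 2: "((\<lambda>u. (\<integral>x. H2 x * (expfun a x * cnj (u x)) \<partial>lborel) * (\<integral>x. \<psi> x * (cnj (expfun a x) * u x) \<partial>lborel))
    has_sum of_real (measure lebesgue \<Omega>) * (\<integral>x. H2 x * \<psi> x \<partial>lborel)) (expfun ` \<Lambda>)"
    by (rule insert.IH[OF _ _ b2 s2]) (use insert.prems(1) in auto)
  have 3: "(\<integral>x. H x * (expfun a x * cnj (u x)) \<partial>lborel)
      = (\<integral>x. H1 x * (expfun a x * cnj (u x)) \<partial>lborel) + (\<integral>x. H2 x * (expfun a x * cnj (u x)) \<partial>lborel)"
    if "u \<in> expfun ` \<Lambda>" for u
    using that by (intro add[where B = 1]) (auto simp: norm_mult)
  have 4: "(\<integral>x. H x * \<psi> x \<partial>lborel) = (\<integral>x. H1 x * \<psi> x \<partial>lborel) + (\<integral>x. H2 x * \<psi> x \<partial>lborel)"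
    by (rule add[OF m\<psi> b\<psi>])
  show ?case
    unfolding 4 distrib_left using has_sum_add[OF 1 2]
    by (simp add: 3 distrib_right cong: has_sum_cong)
qed

text \<open>The term of the tiling sum at \<open>expfun b\<close> is
  \<open>fourier G (b - a) * fourier \<psi> (a - b)\<close>, a product of nonnegative reals. Taking
  \<open>a\<close> in the spectrum makes the term at \<open>expfun a\<close> the left-hand side, and
  a single term is at most the sum.\<close>

lemma fourier_zero_product_le:
  fixes G \<psi> :: "'a \<Rightarrow> complex"
  assumes sym: "symmetric_set \<Omega>" and r: "r > 0" and C: "compact C" "\<And>z. z \<in> C \<Longrightarrow> ball ((1/2) *\<^sub>R z) r \<subseteq> \<Omega>"
    and mG: "G \<in> borel_measurable borel" and m\<psi>: "\<psi> \<in> borel_measurable borel"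
    and bG: "\<And>x. cmod (G x) \<le> BG" and b\<psi>: "\<And>x. cmod (\<psi> x) \<le> B\<psi>"
    and sG: "\<And>x. x \<notin> C \<Longrightarrow> G x = 0" and s\<psi>: "\<And>x. x \<notin> ball 0 r \<Longrightarrow> \<psi> x = 0"
    and FG: "\<And>\<xi>. fourier G \<xi> \<in> \<real>\<^sub>\<ge>\<^sub>0" and F\<psi>: "\<And>\<xi>. fourier \<psi> \<xi> \<in> \<real>\<^sub>\<ge>\<^sub>0"
  shows "Re (fourier G 0 * fourier \<psi> 0) \<le> measure lebesgue \<Omega> * Re (\<integral>x. G x * \<psi> x \<partial>lborel)"
proof -
  \<comment> \<open>Total boundedness gives centres inside \<open>C\<close>, where the inclusion of
    the half-centred balls is available; symmetry of \<open>\<Omega>\<close> supplies the opposite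
    balls.\<close>
  obtain Z where Z: "finite Z" "Z \<subseteq> C" "C \<subseteq> (\<Union>z\<in>Z. ball z r)"
    using seq_compact_imp_totally_bounded[of C] C(1) r by (auto simp: compact_eq_seq_compact_metric)
  \<comment> \<open>With an empty basis the only combination is zero, so the constant 1 would have
    arbitrarily small norm on a set of positive measure.\<close>
  have "expfun ` \<Lambda> \<noteq> {}"
  proof
    assume empty: "expfun ` \<Lambda> = {}"
    have "(\<lambda>x. 1) \<in> L2 \<Omega>"
      by (rule L2_bounded[OF open_dom bounded_dom, of _ 1]) auto
    then have "L2_norm \<Omega> (\<lambda>x. 1) < \<epsilon>" if "\<epsilon> > 0" for \<epsilon>
      using basis that unfolding orthogonal_basis_L2_def empty by fastforce
    moreover have "L2_norm \<Omega> (\<lambda>x. 1) > 0"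
      unfolding L2_norm_def using measure_pos lmeasurable_open[OF bounded_dom open_dom]
      by (simp add: measure_restrict_space space_restrict_space)
    ultimately show False by blast
  qed
  then obtain a where a: "a \<in> \<Lambda>" by auto
  let ?t = "\<lambda>u. (\<integral>x. G x * (expfun a x * cnj (u x)) \<partial>lborel) * (\<integral>x. \<psi> x * (cnj (expfun a x) * u x) \<partial>lborel)"
  have neg: "ball (- y) r \<subseteq> \<Omega>" if "ball y r \<subseteq> \<Omega>" for y
  proof
    fix x assume "x \<in> ball (- y) r"
    then have "- x \<in> ball y r" by (simp add: dist_norm norm_minus_commute add.commute)
    with that show "x \<in> \<Omega>" using symmetric_setD[OF sym, of x] by auto
  qed
  have "(?t has_sum of_real (measure lebesgue \<Omega>) * (\<integral>x. G x * \<psi> x \<partial>lborel)) (expfun ` \<Lambda>)"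
    by (rule tiling_finite_cover[OF Z(1) m\<psi> b\<psi> s\<psi> _ mG bG]) (use Z C(2) neg sG in blast)+
  then have sum: "((\<lambda>u. Re (?t u)) has_sum measure lebesgue \<Omega> * Re (\<integral>x. G x * \<psi> x \<partial>lborel)) (expfun ` \<Lambda>)"
    by (drule_tac has_sum_Re) simp
  have t: "?t (expfun b) = fourier G (b - a) * fourier \<psi> (a - b)" for b
    unfolding fourier_lborel[OF mG] fourier_lborel[OF m\<psi>] cnj_expfun expfun_add_left[symmetric]
    by simp
  have nonneg: "0 \<le> Re (?t u)" if "u \<in> expfun ` \<Lambda> - {expfun a}" for u
  proof -
    from that obtain b where "u = expfun b" by auto
    then have "?t u \<in> \<real>\<^sub>\<ge>\<^sub>0"
      unfolding t by (simp only: t nonneg_Reals_mult_I FG F\<psi>)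
    then show ?thesis by (simp only: complex_nonneg_Reals_iff)
  qed
  have "(\<Sum>u\<in>{expfun a}. Re (?t u)) \<le> measure lebesgue \<Omega> * Re (\<integral>x. G x * \<psi> x \<partial>lborel)"
    by (rule finite_sum_le_has_sum[OF sum]) (use a nonneg in auto)
  then show ?thesis
    by (simp add: t)
qed

end

section \<open>The upper bound\<close>

lemma bounded_continuous_support:
  fixes f :: "'a::euclidean_space \<Rightarrow> complex"
  assumes "continuous_on UNIV f" "bounded S" "\<And>x. x \<notin> S \<Longrightarrow> f x = 0"
  obtains B where "\<And>x. cmod (f x) \<le> B"
proof -
  have "compact (f ` closure S)"
    using assms(1,2) by (intro compact_continuous_image) (auto intro: continuous_on_subset)
  then obtain B where B: "\<And>y. y \<in> f ` closure S \<Longrightarrow> norm y \<le> B"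
    using compact_imp_bounded bounded_iff by metis
  have "cmod (f x) \<le> max B 0" for x
    using B[of "f x"] assms(3)[of x] closure_subset[of S] by (cases "x \<in> S") (auto simp: le_max_iff_disj)
  then show ?thesis using that by blast
qed

text \<open>The extremal function of a small ball serves as the positive definite bump
  \<open>\<psi>\<close> concentrating at \<open>0\<close>.\<close>

lemma turan_fun_ball:
  assumes "r > 0"
  shows "turan_admissible (ball 0 r) (turan_fun (ball 0 r :: 'a::euclidean_space set))"
    and "\<exists>I>0. (\<integral>x. turan_fun (ball 0 r :: 'a set) x \<partial>lebesgue) = complex_of_real I"
proof -
  let ?B = "ball 0 r :: 'a set"
  have B: "?B \<noteq> {}" "open ?B" "bounded ?B" "convex ?B" "symmetric_set ?B"
    using assms by (auto simp: symmetric_set_def image_iff intro!: exI[of _ "- _"] bexI[of _ "- _"])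
  show "turan_admissible ?B (turan_fun ?B)"
    by (rule turan_admissible_integral_turan_fun[OF B])
  have "measure lebesgue ?B > 0"
    by (rule measure_lebesgue_open_pos[OF B(2,3,1)])
  then show "\<exists>I>0. (\<integral>x. turan_fun ?B x \<partial>lebesgue) = complex_of_real I"
    using turan_admissible_integral_turan_fun(2)[OF B] by (intro exI[of _ "measure lebesgue ?B / 2 ^ DIM('a)"]) auto
qed

context spectral_basis
begin

text \<open>For \<open>s < 1\<close> the halved support of \<open>G\<close> lies in \<open>s\<close>
  times the closure of \<open>\<Omega>\<close>, a compact subset of the open set
  \<open>\<Omega>\<close>; this leaves room for a bump of positive radius. The error
  \<open>e\<close> absorbs the variation of \<open>G\<close> over that bump.\<close>

lemma dilated_integral_le:
  assumes conv: "convex \<Omega>" and sym: "symmetric_set \<Omega>" and f: "turan_admissible \<Omega> f"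
    and s: "0 < s" "s < 1"
  shows "(2 * s) ^ DIM('a) * Re (\<integral>x. f x \<partial>lebesgue) \<le> measure lebesgue \<Omega>"
proof (rule field_le_epsilon)
  fix e :: real assume e: "e > 0"
  define N where "N = measure lebesgue \<Omega>"
  have N: "N > 0" using measure_pos by (simp add: N_def)
  \<comment> \<open>Chosen so that \<open>N * (1 + \<eta>) = N + e\<close>.\<close>
  define \<eta> where "\<eta> = e / N"
  have \<eta>: "\<eta> > 0" using e N by (simp add: \<eta>_def)
  have contf: "continuous_on UNIV f" and Ff: "\<And>\<xi>. fourier f \<xi> \<in> \<real>\<^sub>\<ge>\<^sub>0"
    and sf: "\<And>x. x \<notin> \<Omega> \<Longrightarrow> f x = 0" and f0: "f 0 = 1"
    using f by (auto simp: turan_admissible_def positive_definite_fun_def supported_in_def)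
  have [measurable]: "f \<in> borel_measurable borel"
    by (rule borel_measurable_continuous_onI[OF contf])
  have zero: "0 \<in> \<Omega>" using sf[of 0] f0 by fastforce
  define G where "G x = f ((1 / (2 * s)) *\<^sub>R x)" for x
  have contG: "continuous_on UNIV G"
    unfolding G_def by (intro continuous_on_compose2[OF contf] continuous_intros) auto
  have mG [measurable]: "G \<in> borel_measurable borel"
    by (rule borel_measurable_continuous_onI[OF contG])
  define C where "C = (*\<^sub>R) (2 * s) ` closure \<Omega>"
  have C: "compact C"
    unfolding C_def using bounded_dom by (intro compact_scaling) auto
  have sG: "G x = 0" if "x \<notin> C" for x
  proof -
    have "(1 / (2 * s)) *\<^sub>R x \<notin> \<Omega>"
    proof
      assume "(1 / (2 * s)) *\<^sub>R x \<in> \<Omega>"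
      then have "(2 * s) *\<^sub>R ((1 / (2 * s)) *\<^sub>R x) \<in> C"
        unfolding C_def using closure_subset by blast
      with that s show False by simp
    qed
    then show ?thesis by (simp add: G_def sf)
  qed
  obtain BG where bG: "\<And>x. cmod (G x) \<le> BG"
    using bounded_continuous_support[OF contG compact_imp_bounded[OF C] sG] by blast
  have "compact ((*\<^sub>R) s ` closure \<Omega>)"
    using bounded_dom by (intro compact_scaling) auto
  moreover have "(*\<^sub>R) s ` closure \<Omega> \<subseteq> \<Omega>"
  proof
    fix y assume "y \<in> (*\<^sub>R) s ` closure \<Omega>"
    then obtain x where x: "x \<in> closure \<Omega>" "y = s *\<^sub>R x" by auto
    \<comment> \<open>Moving a point of the closure of a convex set by a positive fraction towards
      an interior point, here \<open>0\<close>, lands in the interior.\<close>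
    have "x - (1 - s) *\<^sub>R (x - 0) \<in> interior \<Omega>"
      using conv x zero s open_dom
      by (intro mem_interior_closure_convex_shrink) (auto simp: interior_open)
    then show "y \<in> \<Omega>"
      using open_dom x by (simp add: interior_open algebra_simps)
  qed
  ultimately obtain r0 where r0: "r0 > 0" "(\<Union>x\<in>(*\<^sub>R) s ` closure \<Omega>. ball x r0) \<subseteq> \<Omega>"
    using compact_subset_open_imp_ball_epsilon_subset open_dom by metis
  have "isCont G 0"
    using contG by (simp add: continuous_on_eq_continuous_at)
  then obtain r1 where r1: "r1 > 0" "\<And>x. dist x 0 < r1 \<Longrightarrow> dist (G x) (G 0) < \<eta>"
    unfolding continuous_at_eps_delta dist_norm using \<eta> by (metis diff_zero)
  \<comment> \<open>\<open>r0\<close> keeps the half-centred balls inside \<open>\<Omega>\<close>;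
    \<open>r1\<close> keeps \<open>G\<close> within \<open>\<eta>\<close> of \<open>G 0 = 1\<close>
    on the support of \<open>\<psi>\<close>.\<close>
  define r where "r = min r0 r1"
  have r: "r > 0" using r0 r1 by (simp add: r_def)
  have rC: "ball ((1/2) *\<^sub>R z) r \<subseteq> \<Omega>" if "z \<in> C" for z
  proof -
    from that obtain x where x: "x \<in> closure \<Omega>" "z = (2 * s) *\<^sub>R x" by (auto simp: C_def)
    then have "(1/2) *\<^sub>R z = s *\<^sub>R x" by simp
    moreover have "ball (s *\<^sub>R x) r \<subseteq> ball (s *\<^sub>R x) r0"
      by (intro subset_ball) (simp add: r_def)
    ultimately show ?thesis using r0(2) x(1) by auto
  qed
  have G1: "cmod (G x) \<le> 1 + \<eta>" if "x \<in> ball 0 r" for x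
  proof -
    have "dist (G x) (G 0) < \<eta>" using that by (intro r1(2)) (simp add: r_def dist_norm)
    moreover have "G 0 = 1" by (simp add: G_def f0)
    ultimately show ?thesis
      using norm_triangle_ineq2[of "G x" 1] by (simp add: dist_norm)
  qed
  define \<psi> :: "'a \<Rightarrow> complex" where "\<psi> = turan_fun (ball 0 r)"
  obtain I where I: "I > 0" "(\<integral>x. \<psi> x \<partial>lebesgue) = complex_of_real I"
    using turan_fun_ball(2)[OF r] by (auto simp: \<psi>_def)
  have cont\<psi>: "continuous_on UNIV \<psi>" and F\<psi>: "\<And>\<xi>. fourier \<psi> \<xi> \<in> \<real>\<^sub>\<ge>\<^sub>0"
    and s\<psi>: "\<And>x. x \<notin> ball 0 r \<Longrightarrow> \<psi> x = 0"
    using turan_fun_ball(1)[OF r]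
    by (auto simp: turan_admissible_def positive_definite_fun_def supported_in_def \<psi>_def)
  have \<psi>nn: "\<psi> x \<in> \<real>\<^sub>\<ge>\<^sub>0" for x by (simp add: \<psi>_def turan_fun_nonneg)
  have \<psi>norm: "complex_of_real (cmod (\<psi> x)) = \<psi> x" for x
    using \<psi>nn[of x] by (auto elim!: nonneg_Reals_cases)
  have m\<psi> [measurable]: "\<psi> \<in> borel_measurable borel"
    by (rule borel_measurable_continuous_onI[OF cont\<psi>])
  obtain B\<psi> where b\<psi>: "\<And>x. cmod (\<psi> x) \<le> B\<psi>"
    using bounded_continuous_support[OF cont\<psi> bounded_ball s\<psi>] by blast
  \<comment> \<open>The dilation rescales the frequency, which preserves nonnegativity; at frequency
    \<open>0\<close> it leaves the factor \<open>(2 * s) ^ DIM('a)\<close>.\<close>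
  have FG: "fourier G \<xi> = of_real ((2 * s) ^ DIM('a)) * fourier f ((2 * s) *\<^sub>R \<xi>)" for \<xi>
  proof -
    have "fourier G \<xi> = (2 * s) ^ DIM('a) *\<^sub>R
        (\<integral>x. G (0 + (2 * s) *\<^sub>R x) * expfun (- \<xi>) (0 + (2 * s) *\<^sub>R x) \<partial>lborel)"
      unfolding fourier_lborel[OF mG]
      using s by (subst lborel_integral_affine[where c = "2 * s" and t = 0]) (simp_all, measurable)
    also have "\<dots> = (2 * s) ^ DIM('a) *\<^sub>R fourier f ((2 * s) *\<^sub>R \<xi>)"
      using s by (simp add: fourier_lborel G_def expfun_def)
    finally show ?thesis by (simp add: scaleR_conv_of_real)
  qed
  have FGnn: "fourier G \<xi> \<in> \<real>\<^sub>\<ge>\<^sub>0" for \<xi>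
    unfolding FG using s by (intro nonneg_Reals_mult_I Ff) (simp only: nonneg_Reals_of_real_iff, simp)
  have G0: "fourier G 0 = of_real ((2 * s) ^ DIM('a)) * (\<integral>x. f x \<partial>lebesgue)"
    unfolding FG by (simp add: fourier_def)
  have \<psi>0: "fourier \<psi> 0 = of_real I"
    using I by (simp add: fourier_def)
  have int\<psi>: "integrable lborel (\<lambda>x. cmod (\<psi> x))"
    by (rule integrable_bounded_support[where S = "ball 0 r" and B = B\<psi>]) (auto simp: b\<psi> s\<psi>)
  have I': "(\<integral>x. cmod (\<psi> x) \<partial>lborel) = I"
  proof -
    have "complex_of_real I = (\<integral>x. \<psi> x \<partial>lborel)"
      using I(2) by (simp add: integral_completion)
    also have "\<dots> = of_real (\<integral>x. cmod (\<psi> x) \<partial>lborel)"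
      unfolding integral_complex_of_real[symmetric] \<psi>norm ..
    finally show ?thesis by (simp only: of_real_eq_iff)
  qed
  have "Re (fourier G 0 * fourier \<psi> 0) \<le> N * Re (\<integral>x. G x * \<psi> x \<partial>lborel)"
    unfolding N_def by (rule fourier_zero_product_le[OF sym r C rC mG m\<psi> bG b\<psi> sG s\<psi> FGnn F\<psi>])
  also have "Re (\<integral>x. G x * \<psi> x \<partial>lborel) \<le> (\<integral>x. cmod (G x * \<psi> x) \<partial>lborel)"
    using complex_Re_le_cmod integral_norm_bound order_trans by blast
  also have "\<dots> \<le> (\<integral>x. (1 + \<eta>) * cmod (\<psi> x) \<partial>lborel)"
  proof (rule integral_mono)
    show "integrable lborel (\<lambda>x. (1 + \<eta>) * cmod (\<psi> x))"
      by (intro integrable_mult_right int\<psi>)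
    show le: "cmod (G x * \<psi> x) \<le> (1 + \<eta>) * cmod (\<psi> x)" for x
      using G1[of x] s\<psi>[of x] by (cases "x \<in> ball 0 r") (auto simp: norm_mult intro!: mult_right_mono)
    show "integrable lborel (\<lambda>x. cmod (G x * \<psi> x))"
      by (rule Bochner_Integration.integrable_bound[OF integrable_mult_right[OF int\<psi>, of "1 + \<eta>"]])
        (use le \<eta> in \<open>auto simp: abs_mult\<close>)
  qed
  also have "\<dots> = (1 + \<eta>) * I" by (simp add: I')
  finally have "Re (fourier G 0 * fourier \<psi> 0) \<le> N * ((1 + \<eta>) * I)"
    using N by simp
  \<comment> \<open>Both sides carry the integral \<open>I\<close> of \<open>\<psi>\<close>; as
    \<open>I > 0\<close>, it cancels.\<close>
  then have "((2 * s) ^ DIM('a) * Re (\<integral>x. f x \<partial>lebesgue)) * I \<le> (N * (1 + \<eta>)) * I"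
    unfolding G0 \<psi>0 by (simp add: mult_ac del: of_real_power of_real_mult flip: of_real_mult)
  then have "(2 * s) ^ DIM('a) * Re (\<integral>x. f x \<partial>lebesgue) \<le> N * (1 + \<eta>)"
    using I(1) by simp
  also have "\<dots> = N + e" using N by (simp add: \<eta>_def field_simps)
  finally show "(2 * s) ^ DIM('a) * Re (\<integral>x. f x \<partial>lebesgue) \<le> measure lebesgue \<Omega> + e"
    by (simp add: N_def)
qed

text \<open>The bound for dilations is continuous in \<open>s\<close> and passes to the left limit
  at 1.\<close>

lemma turan_integral_le:
  assumes "convex \<Omega>" "symmetric_set \<Omega>" "turan_admissible \<Omega> f"
  shows "Re (\<integral>x. f x \<partial>lebesgue) \<le> measure lebesgue \<Omega> / 2 ^ DIM('a)"
proof -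
  let ?F = "\<lambda>s. (2 * s) ^ DIM('a) * Re (\<integral>x. f x \<partial>lebesgue)"
  have "(?F \<longlongrightarrow> ?F 1) (at_left 1)"
    by (intro tendsto_intros)
  moreover have "\<forall>\<^sub>F s in at_left (1::real). ?F s \<le> measure lebesgue \<Omega>"
    using eventually_at_left_real[of 0 "1::real"]
    by (rule eventually_mono) (use dilated_integral_le[OF assms] in auto)
  ultimately have "?F 1 \<le> measure lebesgue \<Omega>"
    by (rule tendsto_upperbound) simp
  then show ?thesis by (simp add: field_simps)
qed

end

theorem theorem1:
  fixes \<Omega> :: "(real ^ 'n) set"
  assumes "is_domain \<Omega>"
    and "bounded \<Omega>"
    and "convex \<Omega>"
    and "symmetric_set \<Omega>"
    and "spectral_set \<Omega>"
  shows "turan_domain \<Omega>"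
proof -
  have \<Omega>: "\<Omega> \<noteq> {}" "open \<Omega>" using assms(1) by (auto simp: is_domain_def)
  obtain \<Lambda> where "orthogonal_basis_L2 \<Omega> (expfun ` \<Lambda>)"
    using assms(5) by (auto simp: spectral_set_def)
  then interpret spectral_basis \<Omega> \<Lambda>
    using \<Omega> assms(2) by unfold_locales
  note T = turan_admissible_integral_turan_fun[OF \<Omega> assms(2,3,4)]
  have "Re (\<integral>x. turan_fun \<Omega> x \<partial>lebesgue) = measure lebesgue \<Omega> / 2 ^ DIM(real ^ 'n)"
    unfolding T(2) by (rule Re_complex_of_real)
  \<comment> \<open>The extremal function attains exactly the upper bound, so no admissible function
    has a strictly larger integral.\<close>
  then have "is_arg_max (\<lambda>f. Re (\<integral>x. f x \<partial>lebesgue)) (turan_admissible \<Omega>) (turan_fun \<Omega>)"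
    unfolding is_arg_max_def
    using T(1) turan_integral_le[OF assms(3,4)] by (metis not_less)
  then show ?thesis using assms unfolding turan_domain_def by blast
qed

end
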